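(* Let $n\ge 2$ and let $A_1,\dots,A_{2n^2}\in M_n(\mathbb{C})$ be $\mathbb{R}$-linearly independent invertible matrices. Then the full-rate space-time code $X=\sum_{i=1}^{2n^2}s_iA_i$ is not $g$-group decodable for any $g\ge2$.
   Context: Matrices $A,B\in M_n(\mathbb{C})$ are mutually orthogonal if $AB^*+BA^*=0$, where $^*$ is conjugate transpose. The code $X=\sum_{i=1}^{2l}s_iA_i$ ($s_i$ real symbols, $l\le n^2$) is $g$-group decodable, $g\ge2$, if $\{1,\dots,2l\}$ can be partitioned into nonempty pairwise disjoint subsets $\Gamma_1,\dots,\Gamma_g$ such that $A_u$ and $A_v$ are mutually orthogonal whenever $u\in\Gamma_i$, $v\in\Gamma_j$, $1\le i<j\le g$. Full-rate means $l=n^2$. *)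

theory Defs
  imports "HOL-Analysis.Analysis"
begin

definition conj_transpose :: "complex ^ 'm ^ 'n \<Rightarrow> complex ^ 'n ^ 'm" where
  "conj_transpose A = (\<chi> i j. cnj (A $ j $ i))"

definition mutually_orthogonal ::
  "complex ^ 'n ^ 'n \<Rightarrow> complex ^ 'n ^ 'n \<Rightarrow> bool" where
  "mutually_orthogonal A B \<longleftrightarrow>
     A ** conj_transpose B + B ** conj_transpose A = 0"

text \<open>
  A code in the real symbols \<open>s 1, \<dots>, s (2 * l)\<close> is the matrix-valued linear form
  \<open>s \<mapsto> \<Sum>i = 1..2 * l. s i *\<^sub>R A i\<close>.  Values of \<open>s\<close> and \<open>A\<close> at other indices are irrelevant.
\<close>

definition space_time_code ::
  "nat \<Rightarrow> (nat \<Rightarrow> complex ^ 'n ^ 'n) \<Rightarrow> (nat \<Rightarrow> real) \<Rightarrow> complex ^ 'n ^ 'n" where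
  "space_time_code l A = (\<lambda>s. \<Sum>i = 1..2 * l. s i *\<^sub>R A i)"

text \<open>
  The matrices \<open>A 1, \<dots>, A (2 * l)\<close> are the coefficients of the form \<open>X\<close>, hence determined
  by \<open>X\<close>; the existential quantifier over \<open>A\<close> only names them (see
  \<open>group_decodable_space_time_code_iff\<close> below).
\<close>

definition group_decodable ::
  "nat \<Rightarrow> nat \<Rightarrow> ((nat \<Rightarrow> real) \<Rightarrow> complex ^ 'n ^ 'n) \<Rightarrow> bool" where
  "group_decodable g l X \<longleftrightarrow>
     (\<exists>A. X = space_time_code l A \<and>
       (\<exists>\<Gamma> :: nat \<Rightarrow> nat set.
          (\<Union>i\<in>{1..g}. \<Gamma> i) = {1..2 * l} \<and>
          (\<forall>i\<in>{1..g}. \<Gamma> i \<noteq> {}) \<and>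
          disjoint_family_on \<Gamma> {1..g} \<and>
          (\<forall>i j u v. 1 \<le> i \<and> i < j \<and> j \<le> g \<and> u \<in> \<Gamma> i \<and> v \<in> \<Gamma> j \<longrightarrow>
             mutually_orthogonal (A u) (A v))))"

lemma space_time_code_unit:
  assumes "k \<in> {1..2 * l}"
  shows "space_time_code l A (\<lambda>i. if i = k then 1 else 0) = A k"
proof -
  have "space_time_code l A (\<lambda>i. if i = k then 1 else 0)
          = (\<Sum>i = 1..2 * l. if i = k then A i else 0)"
    unfolding space_time_code_def by (intro sum.cong) auto
  also have "\<dots> = A k"
    using assms by (subst sum.delta) auto
  finally show ?thesis .
qed

lemma group_decodable_space_time_code_iff:
  "group_decodable g l (space_time_code l A) \<longleftrightarrow>
     (\<exists>\<Gamma> :: nat \<Rightarrow> nat set.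
        (\<Union>i\<in>{1..g}. \<Gamma> i) = {1..2 * l} \<and>
        (\<forall>i\<in>{1..g}. \<Gamma> i \<noteq> {}) \<and>
        disjoint_family_on \<Gamma> {1..g} \<and>
        (\<forall>i j u v. 1 \<le> i \<and> i < j \<and> j \<le> g \<and> u \<in> \<Gamma> i \<and> v \<in> \<Gamma> j \<longrightarrow>
           mutually_orthogonal (A u) (A v)))"
  (is "?L \<longleftrightarrow> ?R")
proof
  assume ?R
  then show ?L
    unfolding group_decodable_def by blast
next
  assume ?L
  then obtain B and \<Gamma> :: "nat \<Rightarrow> nat set"
    where eq: "space_time_code l A = space_time_code l B"
      and un: "(\<Union>i\<in>{1..g}. \<Gamma> i) = {1..2 * l}"
      and ne: "\<forall>i\<in>{1..g}. \<Gamma> i \<noteq> {}"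
      and dj: "disjoint_family_on \<Gamma> {1..g}"
      and orth: "\<forall>i j u v. 1 \<le> i \<and> i < j \<and> j \<le> g \<and> u \<in> \<Gamma> i \<and> v \<in> \<Gamma> j \<longrightarrow>
             mutually_orthogonal (B u) (B v)"
    unfolding group_decodable_def by blast
  have AB: "A k = B k" if "k \<in> {1..2 * l}" for k
    using space_time_code_unit[OF that, of A] space_time_code_unit[OF that, of B] eq by simp
  have "mutually_orthogonal (A u) (A v)"
    if "1 \<le> i" "i < j" "j \<le> g" "u \<in> \<Gamma> i" "v \<in> \<Gamma> j" for i j u v
  proof -
    have "i \<in> {1..g}" "j \<in> {1..g}"
      using that by auto
    then have "u \<in> {1..2 * l}" "v \<in> {1..2 * l}"
      using that un by blast+
    then show ?thesis
      using orth that AB by metis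
  qed
  then show ?R
    using un ne dj by blast
qed

end

theory Submission
  imports Defs
begin

text \<open>
  Split the code into two mutually orthogonal groups, spanning \<open>V\<close> and \<open>W\<close>, and let \<open>K\<close> be the
  real space of skew-Hermitian matrices, of dimension at most \<open>n\<^sup>2\<close>.  If \<open>A\<close> is an
  invertible member of one group, then orthogonality says that \<open>A\<^sup>-\<^sup>1 B\<close> is skew-Hermitian for all
  \<open>B\<close> in the other group, so both spans have dimension at most \<open>n\<^sup>2\<close>.  The dimensions
  add up to \<open>2 n\<^sup>2\<close>, hence \<open>W = A K\<close> for any \<open>A\<close> in the first group.
  But a matrix orthogonal to all of \<open>A K\<close> is a real multiple of \<open>A\<close>, because \<open>K\<close>
  has trivial commutant; so \<open>dim V \<le> 1\<close>, whereas \<open>dim V = n\<^sup>2\<close>.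
\<close>

section \<open>Scalar matrices, real-linear maps and adjoints\<close>

lemma mat_mul_nth: "(mat c ** X) $ i $ j = c * (X :: 'a :: semiring_1 ^ 'm ^ 'n) $ i $ j"
  by (simp add: matrix_matrix_mult_def mat_def mult_delta_left)

lemma mul_mat_nth: "(X ** mat c) $ i $ j = (X :: 'a :: semiring_1 ^ 'm ^ 'n) $ i $ j * c"
  by (simp add: matrix_matrix_mult_def mat_def mult_delta_right)

lemma mat_mul_commute: "mat c ** X = (X :: complex ^ 'n ^ 'n) ** mat c"
  by (simp add: vec_eq_iff mat_mul_nth mul_mat_nth)

lemma matrix_mul_uminus_left: "(- A) ** B = - (A ** (B :: 'a :: ring_1 ^ 'm ^ 'n))"
  by (simp add: matrix_matrix_mult_def vec_eq_iff sum_negf)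

lemma matrix_mul_uminus_right: "A ** (- B) = - (A ** (B :: 'a :: ring_1 ^ 'm ^ 'n))"
  by (simp add: matrix_matrix_mult_def vec_eq_iff sum_negf)

lemma matrix_add_rdistrib: "(A + B) ** C = A ** C + B ** (C :: 'a :: semiring_1 ^ 'm ^ 'n)"
  by (simp add: matrix_matrix_mult_def vec_eq_iff sum.distrib distrib_right)

lemma linear_matrix_mul_left: "linear (\<lambda>X :: complex ^ 'm ^ 'n. A ** X)"
  by (rule linearI)
    (simp_all add: matrix_add_ldistrib, simp add: matrix_matrix_mult_def vec_eq_iff scaleR_sum_right)

lemma linear_matrix_mul_right: "linear (\<lambda>X :: complex ^ 'm ^ 'n. X ** A)"
  by (rule linearI)
    (simp_all add: matrix_add_rdistrib, simp add: matrix_matrix_mult_def vec_eq_iff scaleR_sum_right)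

lemma linear_conj_transpose: "linear (conj_transpose :: complex ^ 'm ^ 'n \<Rightarrow> _)"
  by (rule linearI) (simp_all add: conj_transpose_def vec_eq_iff)

lemma conj_transpose_mul:
  "conj_transpose (A ** B) = conj_transpose B ** conj_transpose (A :: complex ^ 'm ^ 'n)"
  by (simp add: conj_transpose_def matrix_matrix_mult_def vec_eq_iff mult.commute)

lemma conj_transpose_mat: "conj_transpose (mat c :: complex ^ 'n ^ 'n) = mat (cnj c)"
  by (auto simp: conj_transpose_def mat_def vec_eq_iff)

lemma mutually_orthogonal_sym: "mutually_orthogonal A B \<Longrightarrow> mutually_orthogonal B A"
  by (simp add: mutually_orthogonal_def add.commute)

text \<open>Conjugation leaves the defining map real-linear in \<open>B\<close>. Hence orthogonality
  to a family passes to its real span.\<close>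

lemma subspace_mutually_orthogonal: "subspace {B. mutually_orthogonal A B}"
proof -
  have "linear (\<lambda>B. A ** conj_transpose B + B ** conj_transpose A)"
    using linear_compose[OF linear_conj_transpose linear_matrix_mul_left]
    by (intro linear_compose_add linear_matrix_mul_right) (simp add: o_def)
  then show ?thesis
    unfolding mutually_orthogonal_def by (rule linear_subspace_kernel)
qed

section \<open>Skew-Hermitian matrices as a real space\<close>

definition skew_hermitian :: "(complex ^ 'n ^ 'n) set" where
  "skew_hermitian = {X. conj_transpose X = - X}"

lemma subspace_skew_hermitian: "subspace (skew_hermitian :: (complex ^ 'n ^ 'n) set)"
proof -
  have "skew_hermitian = {X :: complex ^ 'n ^ 'n. conj_transpose X + X = 0}"
    by (auto simp: skew_hermitian_def eq_neg_iff_add_eq_0)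
  then show ?thesis
    by (rule ssubst)
      (rule linear_subspace_kernel[OF linear_compose_add[OF linear_conj_transpose linear_ident]])
qed

lemma mat_i_skew_hermitian: "mat \<i> \<in> skew_hermitian"
  by (simp add: skew_hermitian_def conj_transpose_mat) (simp add: vec_eq_iff mat_def)

text \<open>Multiplication by \<open>mat \<i>\<close> embeds the skew-Hermitian matrices into the
  Hermitian ones, and only 0 is both. So two copies of the space form a direct sum inside a space of
  real dimension \<open>2 * CARD('n)\<^sup>2\<close>.\<close>

lemma dim_skew_hermitian_le:
  "dim (skew_hermitian :: (complex ^ 'n ^ 'n) set) \<le> CARD('n)\<^sup>2"
proof -
  let ?K = "skew_hermitian :: (complex ^ 'n ^ 'n) set"
  let ?J = "\<lambda>X :: complex ^ 'n ^ 'n. mat \<i> ** X"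
  have inj: "inj ?J"
  proof (rule injI)
    fix X Y assume "?J X = ?J Y"
    then show "X = Y"
      by (auto simp: vec_eq_iff mat_mul_nth)
  qed
  have "X = 0" if X: "X \<in> ?K" "X \<in> ?J ` ?K" for X
  proof -
    obtain Y where Y: "Y \<in> ?K" "X = mat \<i> ** Y"
      using X by auto
    have "cnj (X $ j $ i) = - X $ i $ j" "cnj (Y $ j $ i) = - Y $ i $ j" for i j
      using X Y(1) by (auto simp: skew_hermitian_def conj_transpose_def vec_eq_iff)
    moreover have "X $ i $ j = \<i> * Y $ i $ j" for i j
      by (simp add: Y(2) mat_mul_nth)
    \<comment> \<open>Conjugating the (j,i) entry of X = iY costs one sign on the left but two on
      the right.\<close>
    ultimately have "\<i> * Y $ i $ j = - (\<i> * Y $ i $ j)" for i j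
      by (metis complex_cnj_i complex_cnj_mult minus_mult_minus)
    then have "Y $ i $ j = 0" for i j
      by simp
    then show ?thesis
      by (simp add: Y(2) vec_eq_iff mat_mul_nth)
  qed
  moreover have K: "subspace ?K" and JK: "subspace (?J ` ?K)"
    by (intro subspace_skew_hermitian linear_subspace_image linear_matrix_mul_left)+
  ultimately have "?K \<inter> ?J ` ?K = {0}"
    using subspace_0[OF K] subspace_0[OF JK] by blast
  then have sums: "dim {x + y |x y. x \<in> ?K \<and> y \<in> ?J ` ?K} = dim ?K + dim (?J ` ?K)"
    using dim_sums_Int[OF K JK] by simp
  have "dim (?J ` ?K) = dim ?K"
    by (intro dim_image_eq linear_matrix_mul_left inj_on_subset[OF inj]) auto
  then have "2 * dim ?K = dim {x + y |x y. x \<in> ?K \<and> y \<in> ?J ` ?K}"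
    by (simp only: sums mult_2)
  also have "\<dots> \<le> DIM(complex ^ 'n ^ 'n)"
    by (rule dim_subset_UNIV)
  finally have "2 * dim ?K \<le> DIM(complex ^ 'n ^ 'n)" .
  then show ?thesis
    by (simp add: power2_eq_square)
qed

section \<open>Orthogonality to an invertible matrix\<close>

lemma orthogonal_invertible_imp_mem:
  fixes A B :: "complex ^ 'n ^ 'n"
  assumes "invertible A" "mutually_orthogonal A B"
  shows "B \<in> (**) A ` skew_hermitian"
proof -
  obtain A' where A': "A ** A' = mat 1" "A' ** A = mat 1"
    using assms(1) by (auto simp: invertible_def)
  have adj: "conj_transpose A ** conj_transpose A' = mat 1"
    by (metis A'(2) conj_transpose_mul conj_transpose_mat complex_cnj_one)
  \<comment> \<open>Sandwiching between the inverse of \<open>A\<close> and its adjoint cancels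
    \<open>A\<close> in both summands, leaving the skew-Hermitian condition for
    \<open>A' ** B\<close>.\<close>
  have "A' ** (A ** conj_transpose B + B ** conj_transpose A) ** conj_transpose A' = 0"
    using assms(2) by (simp add: mutually_orthogonal_def matrix_matrix_mult_def vec_eq_iff)
  then have "(A' ** A) ** conj_transpose B ** conj_transpose A'
      + A' ** B ** (conj_transpose A ** conj_transpose A') = 0"
    by (simp add: matrix_add_ldistrib matrix_add_rdistrib matrix_mul_assoc)
  then have "conj_transpose (A' ** B) + A' ** B = 0"
    by (simp add: A' adj conj_transpose_mul)
  then have "A' ** B \<in> skew_hermitian"
    by (simp add: skew_hermitian_def eq_neg_iff_add_eq_0)
  moreover have "B = A ** (A' ** B)"
    by (simp add: matrix_mul_assoc A')
  ultimately show ?thesis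
    by blast
qed

lemma dim_orthogonal_le:
  fixes A :: "complex ^ 'n ^ 'n"
  assumes "invertible A" "\<And>B. B \<in> S \<Longrightarrow> mutually_orthogonal A B"
  shows "dim S \<le> CARD('n)\<^sup>2"
proof -
  have "dim S \<le> dim ((**) A ` skew_hermitian)"
    using assms by (intro dim_subset) (auto intro: orthogonal_invertible_imp_mem)
  also have "\<dots> \<le> dim (skew_hermitian :: (complex ^ 'n ^ 'n) set)"
    by (rule dim_image_le[OF linear_matrix_mul_left])
  also have "\<dots> \<le> CARD('n)\<^sup>2"
    by (rule dim_skew_hermitian_le)
  finally show ?thesis .
qed

section \<open>Commutants\<close>

lemma commuting_matrix_scalar:
  fixes C :: "complex ^ 'n ^ 'n"
  assumes "\<And>X. C ** X = X ** C"
  shows "\<exists>c. C = mat c"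
proof -
  have "C $ i $ p = (if i = p then C $ q $ q else 0)" for i p q
  proof -
    \<comment> \<open>A matrix unit. Entry (i,q) of the two products shows that \<open>C\<close> is
      diagonal when i and p differ, and that its diagonal is constant when they agree.\<close>
    let ?E = "(\<chi> i j. if i = p \<and> j = q then 1 else 0) :: complex ^ 'n ^ 'n"
    have "(C ** ?E) $ i $ q = C $ i $ p"
      by (simp add: matrix_matrix_mult_def mult_delta_right)
    moreover have "(?E ** C) $ i $ q = (if i = p then C $ q $ q else 0)"
      by (simp add: matrix_matrix_mult_def mult_delta_left)
    ultimately show ?thesis
      using assms by metis
  qed
  then have "C = mat (C $ q $ q)" for q
    by (simp add: vec_eq_iff mat_def)
  then show ?thesis
    by blast
qed

text \<open>Skew-Hermitian matrices span all matrices over the complex numbers: 2X = P + iQ with P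
  and Q skew-Hermitian. Scalars commute with \<open>C\<close>, so \<open>C\<close> commutes with
  everything.\<close>

lemma commuting_skew_hermitian_scalar:
  fixes C :: "complex ^ 'n ^ 'n"
  assumes comm: "\<And>X. X \<in> skew_hermitian \<Longrightarrow> C ** X = X ** C"
  shows "\<exists>c. C = mat c"
proof (rule commuting_matrix_scalar)
  fix X :: "complex ^ 'n ^ 'n"
  define P where "P = X - conj_transpose X"
  define Q where "Q = mat (- \<i>) ** (X + conj_transpose X)"
  have "P \<in> skew_hermitian" "Q \<in> skew_hermitian"
    by (simp_all add: P_def Q_def skew_hermitian_def vec_eq_iff mat_mul_nth conj_transpose_def
        algebra_simps)
  then have CP: "C ** P = P ** C" and CQ: "C ** Q = Q ** C"
    using comm by auto
  have X: "X = mat (1/2) ** (P + mat \<i> ** Q)"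
    by (simp add: P_def Q_def vec_eq_iff mat_mul_nth conj_transpose_def algebra_simps)
  have "C ** (P + mat \<i> ** Q) = (P + mat \<i> ** Q) ** C"
    by (metis CP CQ matrix_add_ldistrib matrix_add_rdistrib matrix_mul_assoc mat_mul_commute)
  then have "mat (1/2) ** C ** (P + mat \<i> ** Q) = mat (1/2) ** (P + mat \<i> ** Q) ** C"
    by (simp only: matrix_mul_assoc[symmetric])
  then show "C ** X = X ** C"
    by (simp only: X matrix_mul_assoc mat_mul_commute[of "1/2" C])
qed

text \<open>Writing B = AC turns the hypothesis into CX = XC^* for all skew-Hermitian X. Taking X =
  iI makes C Hermitian, so C commutes with every such X and is scalar; being Hermitian, the scalar
  is real.\<close>

lemma orthogonal_all_imp_span:
  fixes A B :: "complex ^ 'n ^ 'n"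
  assumes "invertible A"
    and orth: "\<And>X. X \<in> skew_hermitian \<Longrightarrow> mutually_orthogonal B (A ** X)"
  shows "B \<in> span {A}"
proof -
  obtain A' where A': "A ** A' = mat 1" "A' ** A = mat 1"
    using assms(1) by (auto simp: invertible_def)
  have adj: "conj_transpose A ** conj_transpose A' = mat 1"
    by (metis A'(2) conj_transpose_mul conj_transpose_mat complex_cnj_one)
  define C where "C = A' ** B"
  have B: "B = A ** C"
    by (simp add: C_def matrix_mul_assoc A')
  have CX: "C ** X = X ** conj_transpose C" if X: "X \<in> skew_hermitian" for X
  proof -
    have X': "conj_transpose X = - X"
      using X by (simp add: skew_hermitian_def)
    have E: "A ** X ** conj_transpose C ** conj_transpose A = A ** C ** X ** conj_transpose A"
      using orth[OF X]
      by (simp add: mutually_orthogonal_def B conj_transpose_mul X' matrix_mul_uminus_left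
          matrix_mul_uminus_right matrix_mul_assoc)
    have "(A' ** A) ** X ** conj_transpose C ** (conj_transpose A ** conj_transpose A')
        = (A' ** A) ** C ** X ** (conj_transpose A ** conj_transpose A')"
      using arg_cong[OF E, of "\<lambda>M. A' ** M ** conj_transpose A'"]
      by (simp add: matrix_mul_assoc)
    then show ?thesis
      by (simp add: A' adj)
  qed
  have "mat \<i> ** C = mat \<i> ** conj_transpose C"
    using CX[OF mat_i_skew_hermitian] by (simp add: mat_mul_commute)
  then have C: "conj_transpose C = C"
    by (auto simp: vec_eq_iff mat_mul_nth)
  then obtain c where c: "C = mat c"
    using commuting_skew_hermitian_scalar CX by metis
  have "cnj c = c"
    \<comment> \<open>Any diagonal entry serves; index types are nonempty.\<close>
    using arg_cong[OF C, of "\<lambda>M. M $ undefined $ undefined"]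
    by (simp add: c conj_transpose_def mat_def)
  then obtain r where r: "c = complex_of_real r"
    by (metis Reals_cases Reals_cnj_iff)
  have "B = r *\<^sub>R A"
    by (simp add: B c r vec_eq_iff mul_mat_nth scaleR_conv_of_real[where 'a = complex] mult.commute)
  then show ?thesis
    by (simp add: span_base span_scale)
qed

section \<open>Counting dimensions of two groups\<close>

theorem theorem6:
  fixes A :: "nat \<Rightarrow> complex ^ 'n ^ 'n" and g :: nat
  assumes "CARD('n) \<ge> 2"
    and "inj_on A {1..2 * CARD('n)^2}"
    and "independent (A ` {1..2 * CARD('n)^2})"
    and "\<And>i. i \<in> {1..2 * CARD('n)^2} \<Longrightarrow> invertible (A i)"
    and "g \<ge> 2"
  shows "\<not> group_decodable g (CARD('n)^2) (space_time_code (CARD('n)^2) A)"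
proof
  let ?I = "{1..2 * CARD('n)^2}"
  let ?K = "skew_hermitian :: (complex ^ 'n ^ 'n) set"
  assume "group_decodable g (CARD('n)^2) (space_time_code (CARD('n)^2) A)"
  then obtain \<Gamma> :: "nat \<Rightarrow> nat set"
    where un: "(\<Union>i\<in>{1..g}. \<Gamma> i) = ?I"
      and ne: "\<forall>i\<in>{1..g}. \<Gamma> i \<noteq> {}"
      and dj: "disjoint_family_on \<Gamma> {1..g}"
      and orth: "\<forall>i j u v. 1 \<le> i \<and> i < j \<and> j \<le> g \<and> u \<in> \<Gamma> i \<and> v \<in> \<Gamma> j \<longrightarrow>
             mutually_orthogonal (A u) (A v)"
    unfolding group_decodable_space_time_code_iff by blast
  \<comment> \<open>Merging all groups but the first reduces the claim to two groups.\<close>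
  define P where "P = \<Gamma> 1"
  define Q where "Q = ?I - P"
  have one_two: "1 \<in> {1..g}" "2 \<in> {1..g}"
    using \<open>g \<ge> 2\<close> by auto
  have P: "P \<subseteq> ?I"
    using un one_two unfolding P_def by blast
  have PQ: "mutually_orthogonal (A u) (A v)" if "u \<in> P" "v \<in> Q" for u v
  proof -
    obtain j where "j \<in> {1..g}" "v \<in> \<Gamma> j"
      using \<open>v \<in> Q\<close> un unfolding Q_def by blast
    moreover from this have "j \<noteq> 1"
      using \<open>v \<in> Q\<close> by (auto simp: Q_def P_def)
    ultimately show ?thesis
      using orth \<open>u \<in> P\<close> unfolding P_def by (metis atLeastAtMost_iff le_neq_implies_less order_refl)
  qed
  obtain p where p: "p \<in> P"
    using ne one_two unfolding P_def by blast
  obtain q where "q \<in> \<Gamma> 2"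
    using ne one_two by blast
  moreover have "\<Gamma> 1 \<inter> \<Gamma> 2 = {}"
    using dj one_two by (auto simp: disjoint_family_on_def)
  ultimately have q: "q \<in> Q"
    using un one_two unfolding Q_def P_def by blast
  have inv: "invertible (A p)" "invertible (A q)"
    using assms(4) p q P unfolding Q_def by blast+
  have dim_image: "dim (A ` S) = card S" if "S \<subseteq> ?I" for S
    using that assms(2,3)
    by (metis card_image dim_eq_card_independent image_mono independent_mono inj_on_subset)
  \<comment> \<open>The two dimensions add up to twice their common upper bound, so both attain
    it.\<close>
  have "card P + card Q = 2 * CARD('n)\<^sup>2"
    using card_mono[OF _ P] P by (simp add: Q_def card_Diff_subset finite_subset)
  moreover have "dim (A ` P) \<le> CARD('n)\<^sup>2"
    using PQ q by (intro dim_orthogonal_le[OF inv(2)]) (auto intro: mutually_orthogonal_sym)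
  moreover have "dim (A ` Q) \<le> CARD('n)\<^sup>2"
    using PQ p by (intro dim_orthogonal_le[OF inv(1)]) auto
  ultimately have dims: "dim (A ` P) = CARD('n)\<^sup>2" "dim (A ` Q) = CARD('n)\<^sup>2"
    using dim_image[OF P] dim_image[of Q] by (auto simp: Q_def)
  have sub: "subspace ((**) (A p) ` ?K)"
    by (intro linear_subspace_image linear_matrix_mul_left subspace_skew_hermitian)
  have "A ` Q \<subseteq> (**) (A p) ` ?K"
    using PQ p inv by (auto intro: orthogonal_invertible_imp_mem)
  then have "span (A ` Q) \<subseteq> (**) (A p) ` ?K"
    by (rule span_minimal[OF _ sub])
  \<comment> \<open>The inclusion just shown is an equality, since the larger space has dimension at
    most that of the smaller.\<close>
  moreover have "dim ((**) (A p) ` ?K) \<le> dim (span (A ` Q))"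
    using dim_image_le[OF linear_matrix_mul_left, of "A p" ?K] dim_skew_hermitian_le[where 'n = 'n]
    by (simp add: dims)
  ultimately have span_Q: "span (A ` Q) = (**) (A p) ` ?K"
    by (intro subspace_dim_equal sub subspace_span)
  \<comment> \<open>Each \<open>B\<close> in the first group is orthogonal to the span of the
    second, which is now known to be the full image of \<open>?K\<close> under
    \<open>A p\<close>.\<close>
  have "A ` P \<subseteq> span {A p}"
  proof
    fix B assume "B \<in> A ` P"
    then have "span (A ` Q) \<subseteq> {X. mutually_orthogonal B X}"
      using PQ by (intro span_minimal subspace_mutually_orthogonal) auto
    then show "B \<in> span {A p}"
      unfolding span_Q by (intro orthogonal_all_imp_span inv) auto
  qed
  then have "dim (A ` P) \<le> card {A p}"
    by (rule dim_le_card) simp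
  then have "CARD('n)\<^sup>2 \<le> 1"
    by (simp add: dims)
  moreover have "2\<^sup>2 \<le> CARD('n)\<^sup>2"
    using assms(1) by (rule power_mono) simp
  ultimately show False
    by simp
qed

end
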